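(* For all integers $n\ge 2$, \[ b(n,2)=p(n,2)=3E(n-1,2)-2\binom{n}{3}+\binom{n}{2}-1. \]
   Context: For a permutation $\pi=\pi_1\cdots\pi_n\in S_n$, a position $i\in\{1,\dots,n-1\}$ is an ascent if $\pi_i<\pi_{i+1}$ and a descent if $\pi_i>\pi_{i+1}$. The permutation $\pi$ is called ballot if for every $1\le k\le n-1$, the number of ascents among positions $1,\dots,k$ is at least the number of descents among positions $1,\dots,k$. Let $b(n,d)$ be the number of ballot permutations in $S_n$ with exactly $d$ descents. For a cycle $\mathfrak c=(c_1,\dots,c_k)$ of a permutation (fixed points are cycles of length 1), let $\mathrm{cA}(\mathfrak c)$ be the number of $i\in\{1,\dots,k\}$ with $c_i\le c_{i+1}$ and $\mathrm{cD}(\mathfrak c)$ the number with $c_i>c_{i+1}$, where $c_{k+1}=c_1$; let $M(\mathfrak c)=\min(\mathrm{cA}(\mathfrak c),\mathrm{cD}(\mathfrak c))$, and for a permutation $\pi$ let $M(\pi)$ be the sum of $M$ over its cycles. Let $p(n,d)$ be the number of permutations in $S_n$ all of whose cycles have odd length and with $M(\pi)=d$. $E(n,d)$ denotes the Eulerian number: the number of permutations of $[n]$ with exactly $d$ descents, with $E(0,0)=1$ and $E(0,d)=0$ for $d\ge1$. *)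

theory Defs
  imports "HOL-Combinatorics.Cycles"
begin

definition ascents :: "nat \<Rightarrow> (nat \<Rightarrow> nat) \<Rightarrow> nat set" where
  "ascents n \<pi> = {i \<in> {1..<n}. \<pi> i < \<pi> (i + 1)}"

definition descents :: "nat \<Rightarrow> (nat \<Rightarrow> nat) \<Rightarrow> nat set" where
  "descents n \<pi> = {i \<in> {1..<n}. \<pi> i > \<pi> (i + 1)}"

definition ballot :: "nat \<Rightarrow> (nat \<Rightarrow> nat) \<Rightarrow> bool" where
  "ballot n \<pi> \<longleftrightarrow>
     (\<forall>k\<in>{1..<n}. card (ascents n \<pi> \<inter> {1..k}) \<ge> card (descents n \<pi> \<inter> {1..k}))"

definition ballot_number :: "nat \<Rightarrow> nat \<Rightarrow> nat" where
  "ballot_number n d =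
     card {\<pi>. \<pi> permutes {1..n} \<and> ballot n \<pi> \<and> card (descents n \<pi>) = d}"

text \<open>A cycle \<open>(c\<^sub>1, \<dots>, c\<^sub>k)\<close> is the list \<open>[c\<^sub>1, \<dots>, c\<^sub>k]\<close>; list indices start
  at \<open>0\<close> and are read modulo the length, which implements \<open>c\<^bsub>k+1\<^esub> = c\<^sub>1\<close>.\<close>

definition cA :: "nat list \<Rightarrow> nat" where
  "cA c = card {i \<in> {..<length c}. c ! i \<le> c ! (Suc i mod length c)}"

definition cD :: "nat list \<Rightarrow> nat" where
  "cD c = card {i \<in> {..<length c}. c ! i > c ! (Suc i mod length c)}"

definition cycle_M :: "nat list \<Rightarrow> nat" where
  "cycle_M c = min (cA c) (cD c)"

text \<open>The list \<open>support \<pi> x\<close> is \<open>[x, \<pi> x, \<pi> (\<pi> x), \<dots>]\<close> up to the first return to \<open>x\<close>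
  (so \<open>[x]\<close> for a fixed point). Each cycle is represented once, by the rotation that
  starts with its least element.\<close>

definition perm_cycles :: "nat \<Rightarrow> (nat \<Rightarrow> nat) \<Rightarrow> nat list set" where
  "perm_cycles n \<pi> = {support \<pi> x | x. x \<in> {1..n} \<and> (\<forall>y \<in> set (support \<pi> x). x \<le> y)}"

definition perm_M :: "nat \<Rightarrow> (nat \<Rightarrow> nat) \<Rightarrow> nat" where
  "perm_M n \<pi> = (\<Sum>c\<in>perm_cycles n \<pi>. cycle_M c)"

definition odd_cycle_number :: "nat \<Rightarrow> nat \<Rightarrow> nat" where
  "odd_cycle_number n d =
     card {\<pi>. \<pi> permutes {1..n} \<and> (\<forall>c\<in>perm_cycles n \<pi>. odd (length c)) \<and> perm_M n \<pi> = d}"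

definition eulerian :: "nat \<Rightarrow> nat \<Rightarrow> nat" where
  "eulerian n d = card {\<pi>. \<pi> permutes {1..n} \<and> card (descents n \<pi>) = d}"

lemma eulerian_0: "eulerian 0 d = (if d = 0 then 1 else 0)"
  by (simp add: eulerian_def descents_def)

end

theory Submission
  imports Defs "HOL-Combinatorics.Multiset_Permutations"
begin

text \<open>Permutations whose descents lie in \<open>{i, j}\<close>, \<open>i < j\<close>, are counted by
  \<open>(n choose j) (j choose i)\<close>, so inclusion-exclusion counts those with descent set exactly
  \<open>{i, j}\<close>. A permutation with two descents fails to be ballot only if position 1 is a descent
  or the descents are 2 and 3; summing over the remaining pairs gives \<open>b(n, 2)\<close>.

  A cycle written from its least element is that element followed by an arbitrary ordering of the
  others, and it has one cyclic descent more than this ordering has descents. Reversing the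
  ordering exchanges cyclic ascents and descents, so the cycles on \<open>k > 2 m\<close> points with
  \<open>M = m\<close> number \<open>2 E(k - 1, m - 1)\<close>. A permutation with odd cycles and \<open>M = 2\<close> has either
  one cycle with \<open>M = 2\<close> or two cycles with \<open>M = 1\<close> besides fixed points. Summing over the
  supports of these cycles gives binomial sums over odd indices, in which the terms \<open>(-1)^n\<close> of
  the two cases cancel.\<close>

section \<open>Sums over pairs and over odd subsets\<close>

lemma card_2_less_obtains:
  fixes D :: "'a::linorder set"
  assumes "card D = 2"
  obtains i j where "D = {i, j}" "i < j"
proof -
  obtain x y where "D = {x, y}" "x \<noteq> y" using assms by (auto simp: card_2_iff)
  then show ?thesis
    using that[of x y] that[of y x] by (cases x y rule: linorder_cases) auto
qed

lemma doubletons_atMost_eq: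
  "{D. D \<subseteq> {..n} \<and> card D = 2} = (\<lambda>(j, i). {i, j}) ` (SIGMA j:{..n}. {..<j})" for n :: nat
proof
  show "{D. D \<subseteq> {..n} \<and> card D = 2} \<subseteq> (\<lambda>(j, i). {i, j}) ` (SIGMA j:{..n}. {..<j})"
  proof clarify
    fix D assume "D \<subseteq> {..n}" "card D = 2"
    moreover from this obtain i j where "D = {i, j}" "i < j" using card_2_less_obtains by blast
    ultimately show "D \<in> (\<lambda>(j, i). {i, j}) ` (SIGMA j:{..n}. {..<j})" by force
  qed
qed auto

lemma card_unordered_pairs:
  assumes "finite R" "\<And>x y. (x, y) \<in> R \<Longrightarrow> (y, x) \<in> R \<and> x \<noteq> y"
  shows "card R = 2 * card ((\<lambda>(x, y). {x, y}) ` R)"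
proof -
  let ?f = "\<lambda>(x, y). {x, y}"
  have "card R = (\<Sum>e\<in>?f ` R. card {p \<in> R. ?f p = e})"
    using sum.image_gen[OF assms(1), of "\<lambda>p. 1 :: nat" ?f] by simp
  also have "\<dots> = (\<Sum>e\<in>?f ` R. 2)"
  proof (rule sum.cong[OF refl])
    fix e assume "e \<in> ?f ` R"
    then obtain x y where "e = {x, y}" "(x, y) \<in> R" by auto
    then have "{p \<in> R. ?f p = e} = {(x, y), (y, x)}" "x \<noteq> y"
      using assms(2) by (auto simp: doubleton_eq_iff)
    then show "card {p \<in> R. ?f p = e} = 2" by simp
  qed
  finally show ?thesis by simp
qed

lemma sum_eq_2_iff:
  fixes f :: "'a \<Rightarrow> nat"
  assumes "finite K" "\<And>c. c \<in> K \<Longrightarrow> 0 < f c"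
  shows "sum f K = 2 \<longleftrightarrow>
    (\<exists>c. K = {c} \<and> f c = 2) \<or> (\<exists>c d. c \<noteq> d \<and> K = {c, d} \<and> f c = 1 \<and> f d = 1)"
proof
  assume sum_eq: "sum f K = 2"
  have "card K \<le> sum f K"
    using sum_mono[of K "\<lambda>c. 1" f] assms(2) by (simp add: Suc_leI)
  moreover have "card K \<noteq> 0" using sum_eq assms(1) by auto
  ultimately consider (singleton) "card K = 1" | (doubleton) "card K = 2" using sum_eq by linarith
  then show "(\<exists>c. K = {c} \<and> f c = 2) \<or> (\<exists>c d. c \<noteq> d \<and> K = {c, d} \<and> f c = 1 \<and> f d = 1)"
  proof cases
    case singleton
    then obtain c where "K = {c}" by (rule card_1_singletonE)
    then show ?thesis using sum_eq by simp
  next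
    case doubleton
    then obtain c d where K_eq: "K = {c, d}" "c \<noteq> d" by (auto simp: card_2_iff)
    then have "f c = 1 \<and> f d = 1" using sum_eq assms(2)[of c] assms(2)[of d] by auto
    then show ?thesis using K_eq by blast
  qed
qed auto

lemma sum_pairs_less:
  "(\<Sum>j\<le>n. \<Sum>i<j. f i + f j) = of_nat n * (\<Sum>i\<le>n. f i)" for f :: "nat \<Rightarrow> 'a::comm_semiring_1"
proof (induction n)
  case (Suc n)
  have "(\<Sum>j\<le>Suc n. \<Sum>i<j. f i + f j) = of_nat n * (\<Sum>i\<le>n. f i) + (\<Sum>i\<le>n. f i + f (Suc n))"
    by (simp add: Suc lessThan_Suc_atMost)
  then show ?case by (simp add: sum.distrib algebra_simps)
qed simp

lemma sum_choose_choose_less: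
  "(\<Sum>j\<le>n. int (n choose j) * (\<Sum>i<j. int (j choose i))) = 3 ^ n - 2 ^ n"
proof -
  have "(\<Sum>i<j. int (j choose i)) = 2 ^ j - 1" for j
    using binomial_ring[of "1 :: int" 1 j] by (simp flip: lessThan_Suc_atMost)
  then show ?thesis
    using binomial_ring[of "2 :: int" 1 n] binomial_ring[of "1 :: int" 1 n]
    by (simp only: right_diff_distrib sum_subtractf) simp
qed

lemma double_int_choose_two: "2 * int (n choose 2) = int n * (int n - 1)"
proof -
  have "2 * (n choose 2) = n * (n - 1)"
    using times_binomial_minus1_eq[of 2 n] by simp
  then have "2 * int (n choose 2) = int (n * (n - 1))" by (metis of_nat_mult of_nat_numeral)
  then show ?thesis by (cases n) (simp_all add: algebra_simps)
qed

definition odd_choose_sum :: "nat \<Rightarrow> (nat \<Rightarrow> 'a) \<Rightarrow> 'a::comm_ring_1" where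
  "odd_choose_sum n f = (\<Sum>k | k \<le> n \<and> odd k. of_nat (n choose k) * f k)"

lemma odd_choose_sum_diff:
  "odd_choose_sum n (\<lambda>k. f k - g k) = odd_choose_sum n f - odd_choose_sum n g"
  by (simp add: odd_choose_sum_def right_diff_distrib sum_subtractf)

lemma odd_choose_sum_mult: "odd_choose_sum n (\<lambda>k. a * f k) = a * odd_choose_sum n f"
  by (simp add: odd_choose_sum_def sum_distrib_left mult.left_commute)

lemma odd_choose_sum_cong:
  "(\<And>k. k \<le> n \<Longrightarrow> f k = g k) \<Longrightarrow> odd_choose_sum n f = odd_choose_sum n g"
  by (simp add: odd_choose_sum_def)

lemma odd_choose_sum_power:
  "2 * odd_choose_sum n (\<lambda>k. a ^ k * b ^ (n - k)) = (b + a) ^ n - (b - a) ^ n"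
proof -
  have "(b + a) ^ n - (b - a) ^ n =
      (\<Sum>k\<le>n. of_nat (n choose k) * (a ^ k - (- a) ^ k) * b ^ (n - k))"
    using binomial_ring[of a b n] binomial_ring[of "- a" b n]
    by (simp add: algebra_simps sum_subtractf)
  also have "\<dots> =
      (\<Sum>k | k \<le> n \<and> odd k. of_nat (n choose k) * (a ^ k - (- a) ^ k) * b ^ (n - k))"
    by (intro sum.mono_neutral_right) auto
  also have "\<dots> = 2 * odd_choose_sum n (\<lambda>k. a ^ k * b ^ (n - k))"
    unfolding odd_choose_sum_def sum_distrib_left
    by (intro sum.cong) auto
  finally show ?thesis by simp
qed

lemma odd_choose_sum_1: "2 * odd_choose_sum n (\<lambda>k. 1) = (2 ^ n - 0 ^ n :: 'a::comm_ring_1)"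
  using odd_choose_sum_power[of n "1 :: 'a" 1] by simp

lemma odd_choose_sum_complement:
  assumes "2 \<le> n"
  shows "4 * odd_choose_sum n (\<lambda>k. of_nat (n - k)) = (of_nat n * 2 ^ n :: 'a::comm_ring_1)"
proof -
  have "odd_choose_sum n (\<lambda>k. of_nat (n - k)) =
      (\<Sum>k | k \<le> n \<and> odd k. of_nat n * of_nat (n - 1 choose k) :: 'a)"
    unfolding odd_choose_sum_def
    by (intro sum.cong refl) (metis binomial_absorb_comp mult.commute of_nat_mult)
  also have "\<dots> = (\<Sum>k | k \<le> n - 1 \<and> odd k. of_nat n * of_nat (n - 1 choose k))"
    by (intro sum.mono_neutral_right ballI) (auto simp: binomial_eq_0)
  also have "\<dots> = of_nat n * odd_choose_sum (n - 1) (\<lambda>k. 1)"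
    by (simp add: odd_choose_sum_def sum_distrib_left)
  finally have "4 * odd_choose_sum n (\<lambda>k. of_nat (n - k)) =
      of_nat n * (2 * (2 * odd_choose_sum (n - 1) (\<lambda>k. 1)) :: 'a)"
    by (simp add: algebra_simps)
  also have "\<dots> = of_nat n * 2 ^ n"
    unfolding odd_choose_sum_1 using assms by (cases n) (simp_all add: power_0_left)
  finally show ?thesis .
qed

lemma odd_choose_sum_id:
  assumes "2 \<le> n"
  shows "4 * odd_choose_sum n of_nat = (of_nat n * 2 ^ n :: 'a::comm_ring_1)"
proof -
  have "odd_choose_sum n of_nat = odd_choose_sum n (\<lambda>k. of_nat n * 1 - of_nat (n - k) :: 'a)"
    by (rule odd_choose_sum_cong) (simp add: of_nat_diff)
  also have "\<dots> = of_nat n * odd_choose_sum n (\<lambda>k. 1) - odd_choose_sum n (\<lambda>k. of_nat (n - k))"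
    by (simp only: odd_choose_sum_diff odd_choose_sum_mult)
  finally have "4 * odd_choose_sum n of_nat = 2 * of_nat n * (2 * odd_choose_sum n (\<lambda>k. 1)) -
      (4 * odd_choose_sum n (\<lambda>k. of_nat (n - k)) :: 'a)"
    by (simp only: right_diff_distrib) simp
  also have "\<dots> = of_nat n * 2 ^ n"
    unfolding odd_choose_sum_1 odd_choose_sum_complement[OF assms] using assms
    by (simp add: power_0_left algebra_simps)
  finally show ?thesis .
qed

lemma sum_odd_subsets:
  assumes "finite U"
  shows "(\<Sum>S | S \<subseteq> U \<and> odd (card S). f (card S)) = odd_choose_sum (card U) f"
proof -
  have "(\<Sum>S | S \<subseteq> U \<and> odd (card S). f (card S)) = (\<Sum>k | k \<le> card U \<and> odd k.
      of_nat (card {S \<in> {S. S \<subseteq> U \<and> odd (card S)}. card S = k}) * f k)"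
    by (intro sum_fun_comp) (use assms in \<open>auto simp: card_mono\<close>)
  also have "\<dots> = odd_choose_sum (card U) f"
    unfolding odd_choose_sum_def
  proof (intro sum.cong refl)
    fix k assume "k \<in> {k. k \<le> card U \<and> odd k}"
    then have "{S \<in> {S. S \<subseteq> U \<and> odd (card S)}. card S = k} = {S. S \<subseteq> U \<and> card S = k}" by auto
    then show "of_nat (card {S \<in> {S. S \<subseteq> U \<and> odd (card S)}. card S = k}) * f k =
        of_nat (card U choose k) * f k"
      by (simp add: n_subsets[OF assms])
  qed
  finally show ?thesis .
qed

lemma sum_large_odd_subsets:
  fixes f :: "nat \<Rightarrow> 'a::comm_ring_1"
  assumes "finite U"
  shows "(\<Sum>S | S \<subseteq> U \<and> odd (card S) \<and> 2 * m < card S. f (card S)) =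
    odd_choose_sum (card U) f - (\<Sum>i<m. of_nat (card U choose (2 * i + 1)) * f (2 * i + 1))"
proof (induction m)
  case 0
  have "{S. S \<subseteq> U \<and> odd (card S) \<and> 2 * 0 < card S} = {S. S \<subseteq> U \<and> odd (card S)}"
    by (auto intro: Nat.gr0I)
  then show ?case using sum_odd_subsets[OF assms, of f] by simp
next
  case (Suc m)
  have "{S. S \<subseteq> U \<and> odd (card S) \<and> 2 * m < card S} =
      {S. S \<subseteq> U \<and> odd (card S) \<and> 2 * Suc m < card S} \<union> {S. S \<subseteq> U \<and> card S = 2 * m + 1}"
    by (auto, presburger)
  then have "(\<Sum>S | S \<subseteq> U \<and> odd (card S) \<and> 2 * m < card S. f (card S)) =
      (\<Sum>S | S \<subseteq> U \<and> odd (card S) \<and> 2 * Suc m < card S. f (card S)) +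
      (\<Sum>S | S \<subseteq> U \<and> card S = 2 * m + 1. f (card S))"
    using assms by (simp only:) (intro sum.union_disjoint, auto)
  then show ?case using Suc by (simp add: n_subsets[OF assms] algebra_simps)
qed

section \<open>Descent sets of lists\<close>

definition list_descents :: "'a::linorder list \<Rightarrow> nat set" where
  "list_descents xs = {i. 0 < i \<and> i < length xs \<and> xs ! i < xs ! (i - 1)}"

lemma list_descents_subset: "list_descents xs \<subseteq> {1..<length xs}"
  by (auto simp: list_descents_def)

lemma finite_list_descents [simp]: "finite (list_descents xs)"
  using list_descents_subset by (rule finite_subset) simp

lemma card_list_descents_less: "xs \<noteq> [] \<Longrightarrow> card (list_descents xs) < length xs"
  using card_mono[OF _ list_descents_subset[of xs]] by (cases xs) auto

lemma list_descents_eq_empty_iff: "list_descents xs = {} \<longleftrightarrow> sorted xs"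
proof -
  have "list_descents xs = Suc ` {i. Suc i < length xs \<and> xs ! Suc i < xs ! i}"
    by (auto simp: list_descents_def image_iff gr0_conv_Suc)
  then show ?thesis by (force simp: sorted_iff_nth_Suc not_less)
qed

lemma list_descents_append:
  "list_descents (xs @ ys) - {length xs} = list_descents xs \<union> (+) (length xs) ` list_descents ys"
  (is "?L = ?R")
proof (rule set_eqI)
  fix i
  consider "i \<le> length xs" | k where "i = length xs + k" "0 < k"
    by (metis less_imp_add_positive not_le)
  then show "i \<in> ?L \<longleftrightarrow> i \<in> ?R"
    by cases (auto simp: list_descents_def nth_append)
qed

lemma list_descents_Cons_less:
  assumes "\<And>x. x \<in> set xs \<Longrightarrow> m < x"
  shows "list_descents (m # xs) = Suc ` list_descents xs"
proof -
  have "1 \<notin> list_descents (m # xs)"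
    using assms[of "xs ! 0"] by (auto simp: list_descents_def)
  moreover have "list_descents [m] = {}" by (simp add: list_descents_eq_empty_iff)
  ultimately show ?thesis using list_descents_append[of "[m]" xs] by simp
qed

lemma list_descents_rev:
  assumes "distinct xs"
  shows "list_descents (rev xs) = (\<lambda>i. length xs - i) ` ({1..<length xs} - list_descents xs)"
    (is "_ = ?f ` ?A")
proof
  have reflect: "?f i \<in> list_descents (rev xs) \<longleftrightarrow> i \<notin> list_descents xs"
    if "i \<in> {1..<length xs}" for i
  proof -
    have "rev xs ! ?f i = xs ! (i - 1)" "rev xs ! (?f i - 1) = xs ! i"
      using that by (auto simp: rev_nth)
    moreover have "xs ! (i - 1) \<noteq> xs ! i"
      using that nth_eq_iff_index_eq[OF assms, of "i - 1" i] by (simp, linarith)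
    ultimately show ?thesis using that by (auto simp: list_descents_def)
  qed
  then show "?f ` ?A \<subseteq> list_descents (rev xs)" by auto
  show "list_descents (rev xs) \<subseteq> ?f ` ?A"
  proof
    fix j assume descent: "j \<in> list_descents (rev xs)"
    then have "j \<in> {1..<length xs}" using list_descents_subset[of "rev xs"] by auto
    then have "?f j \<in> {1..<length xs}" "j = ?f (?f j)" by auto
    with descent reflect[of "?f j"] show "j \<in> ?f ` ?A" by (intro rev_image_eqI[of "?f j"]) auto
  qed
qed

lemma card_list_descents_rev:
  assumes "distinct xs"
  shows "card (list_descents (rev xs)) = length xs - 1 - card (list_descents xs)"
proof -
  have "inj_on (\<lambda>i. length xs - i) ({1..<length xs} - list_descents xs)"
    by (auto simp: inj_on_def)
  then have "card (list_descents (rev xs)) = card ({1..<length xs} - list_descents xs)"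
    by (simp only: list_descents_rev[OF assms] card_image)
  then show ?thesis
    by (simp only: card_Diff_subset list_descents_subset finite_list_descents card_atLeastLessThan)
qed

lemma list_descents_append_subset_iff:
  assumes "S \<subseteq> {..<length xs}"
  shows "list_descents (xs @ ys) \<subseteq> insert (length xs) S \<longleftrightarrow> list_descents xs \<subseteq> S \<and> sorted ys"
proof -
  have "list_descents (xs @ ys) \<subseteq> insert (length xs) S \<longleftrightarrow>
      list_descents xs \<union> (+) (length xs) ` list_descents ys \<subseteq> insert (length xs) S"
    using list_descents_append[of xs ys] by auto
  also have "\<dots> \<longleftrightarrow> list_descents xs \<subseteq> S \<and> list_descents ys = {}"
    using list_descents_subset[of xs] list_descents_subset[of ys] assms by fastforce
  finally show ?thesis by (simp add: list_descents_eq_empty_iff)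
qed

definition descent_class :: "'a::linorder set \<Rightarrow> nat set set \<Rightarrow> 'a list set" where
  "descent_class A \<D> = {xs \<in> permutations_of_set A. list_descents xs \<in> \<D>}"

lemma descent_class_cong:
  assumes "\<And>D. D \<subseteq> {1..<card A} \<Longrightarrow> D \<in> \<D> \<longleftrightarrow> D \<in> \<E>"
  shows "descent_class A \<D> = descent_class A \<E>"
proof -
  have "list_descents xs \<in> \<D> \<longleftrightarrow> list_descents xs \<in> \<E>" if "xs \<in> permutations_of_set A" for xs
    using assms list_descents_subset[of xs] length_finite_permutations_of_set[OF that] by simp
  then show ?thesis by (auto simp: descent_class_def)
qed

lemma finite_descent_class [simp]: "finite (descent_class A \<D>)"
  by (simp add: descent_class_def)

lemma card_descent_class_disjoint_Un:
  assumes "\<D> \<inter> \<E> = {}"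
  shows "card (descent_class A (\<D> \<union> \<E>)) = card (descent_class A \<D>) + card (descent_class A \<E>)"
proof -
  have "descent_class A (\<D> \<union> \<E>) = descent_class A \<D> \<union> descent_class A \<E>"
    by (auto simp: descent_class_def)
  moreover have "descent_class A \<D> \<inter> descent_class A \<E> = {}"
    using assms by (auto simp: descent_class_def)
  ultimately show ?thesis by (simp add: card_Un_disjoint)
qed

lemma card_descent_class_sum:
  assumes "finite \<D>"
  shows "card (descent_class A \<D>) = (\<Sum>D\<in>\<D>. card (descent_class A {D}))"
  using assms
proof (induction \<D>)
  case empty
  show ?case by (simp add: descent_class_def)
next
  case (insert D \<D>)
  then show ?case using card_descent_class_disjoint_Un[of "{D}" \<D> A] by simp
qed

lemma card_descent_class_image:
  assumes "finite I" "inj_on g I"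
  shows "card (descent_class A (g ` I)) = (\<Sum>i\<in>I. card (descent_class A {g i}))"
  using assms by (simp only: card_descent_class_sum finite_imageI sum.reindex o_def)

lemma descent_class_Pow_empty:
  assumes "finite A"
  shows "descent_class A (Pow {}) = {sorted_list_of_set A}"
  using assms
  by (auto simp: descent_class_def list_descents_eq_empty_iff permutations_of_set_def
      intro: sorted_distinct_set_unique)

text \<open>A permutation of \<open>A\<close> whose descents lie in \<open>S \<union> {k}\<close> is determined by its first \<open>k\<close>
  entries, since the remaining ones are sorted.\<close>

lemma bij_betw_descent_class_Pow_insert:
  assumes "finite A" "S \<subseteq> {..<k}" "k \<le> card A"
  shows "bij_betw (\<lambda>(B, xs). xs @ sorted_list_of_set (A - B))
    (SIGMA B:{B. B \<subseteq> A \<and> card B = k}. descent_class B (Pow S)) (descent_class A (Pow (insert k S)))"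
    (is "bij_betw ?f ?X ?Y")
proof (rule bij_betw_byWitness[where f' = "\<lambda>xs. (set (take k xs), take k xs)"])
  have length_prefix: "length xs = k" if "(B, xs) \<in> ?X" for B xs
    using that by (auto simp: descent_class_def dest: length_finite_permutations_of_set)
  show "\<forall>u\<in>?X. (set (take k (?f u)), take k (?f u)) = u"
    using length_prefix by (auto simp: descent_class_def permutations_of_set_def)
  show "?f ` ?X \<subseteq> ?Y"
  proof (rule image_subsetI, clarify)
    fix B xs assume "B \<subseteq> A" "k = card B" "xs \<in> descent_class B (Pow S)"
    then show "xs @ sorted_list_of_set (A - B) \<in> descent_class A (Pow (insert (card B) S))"
      using assms(1,2) list_descents_append_subset_iff[of S xs] length_prefix[of B xs]
      by (auto simp: descent_class_def permutations_of_set_def)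
  qed
  have prefix_suffix: "set (take k xs) \<subseteq> A \<and> card (set (take k xs)) = k \<and>
      take k xs \<in> descent_class (set (take k xs)) (Pow S) \<and>
      sorted_list_of_set (A - set (take k xs)) = drop k xs" if "xs \<in> ?Y" for xs
  proof -
    have xs_perm: "distinct xs" "set xs = A" "length xs = card A"
      and "list_descents xs \<subseteq> insert k S"
      using that by (auto simp: descent_class_def permutations_of_set_def distinct_card)
    then have "list_descents (take k xs) \<subseteq> S" "sorted (drop k xs)"
      using list_descents_append_subset_iff[of S "take k xs" "drop k xs"] assms(2,3) by auto
    moreover have "A - set (take k xs) = set (drop k xs)"
      using xs_perm(1,2) set_take_disj_set_drop_if_distinct[of xs k k]
        set_append[of "take k xs" "drop k xs"] by auto
    ultimately show ?thesis
      using xs_perm assms(3) set_take_subset[of k xs]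
      by (simp add: descent_class_def permutations_of_set_def distinct_card
          sorted_distinct_set_unique)
  qed
  then show "\<forall>xs\<in>?Y. ?f (set (take k xs), take k xs) = xs"
    by simp
  from prefix_suffix show "(\<lambda>xs. (set (take k xs), take k xs)) ` ?Y \<subseteq> ?X" by blast
qed

lemma card_descent_class_Pow_insert:
  assumes "finite A" "S \<subseteq> {..<k}" "k \<le> card A"
  shows "card (descent_class A (Pow (insert k S))) =
    (\<Sum>B | B \<subseteq> A \<and> card B = k. card (descent_class B (Pow S)))"
  using bij_betw_same_card[OF bij_betw_descent_class_Pow_insert[OF assms]] assms(1) by simp

lemma card_descent_class_Pow_empty:
  assumes "finite A"
  shows "card (descent_class A (Pow {})) = 1"
  by (simp only: descent_class_Pow_empty[OF assms]) simp

lemma card_descent_class_Pow_singleton: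
  assumes "finite A" "k \<le> card A"
  shows "card (descent_class A (Pow {k})) = card A choose k"
proof -
  have "card (descent_class A (Pow {k})) = (\<Sum>B | B \<subseteq> A \<and> card B = k. 1)"
    unfolding card_descent_class_Pow_insert[OF assms(1) empty_subsetI assms(2)]
    by (intro sum.cong refl card_descent_class_Pow_empty) (auto intro: finite_subset[OF _ assms(1)])
  then show ?thesis by (simp add: n_subsets[OF assms(1)])
qed

lemma card_descent_class_Pow_doubleton:
  assumes "finite A" "i < j" "j \<le> card A"
  shows "card (descent_class A (Pow {i, j})) = (card A choose j) * (j choose i)"
proof -
  have "card (descent_class A (Pow {j, i})) =
      (\<Sum>B | B \<subseteq> A \<and> card B = j. card (descent_class B (Pow {i})))"
    using assms by (intro card_descent_class_Pow_insert) auto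
  also have "\<dots> = (\<Sum>B | B \<subseteq> A \<and> card B = j. j choose i)"
    using assms by (intro sum.cong refl) (auto simp: card_descent_class_Pow_singleton finite_subset)
  finally show ?thesis by (simp add: n_subsets[OF assms(1)] insert_commute)
qed

lemma card_descent_class_empty:
  assumes "finite A"
  shows "card (descent_class A {{}}) = 1"
  using card_descent_class_Pow_empty[OF assms] by simp

lemma card_descent_class_singleton:
  assumes "finite A" "k \<le> card A"
  shows "int (card (descent_class A {{k}})) = int (card A choose k) - 1"
proof -
  have "card A choose k = card (descent_class A {{}}) + card (descent_class A {{k}})"
    unfolding card_descent_class_Pow_singleton[OF assms, symmetric]
    by (subst card_descent_class_sum) (simp_all add: Pow_insert)
  then show ?thesis by (simp add: card_descent_class_empty[OF assms(1)])
qed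

lemma card_descent_class_doubleton:
  assumes "finite A" "i < j" "j \<le> card A"
  shows "int (card (descent_class A {{i, j}})) =
    int (card A choose j) * int (j choose i) - int (card A choose i) - int (card A choose j) + 1"
proof -
  have "(card A choose j) * (j choose i) =
      card (descent_class A {{}}) + card (descent_class A {{i}}) +
      card (descent_class A {{j}}) + card (descent_class A {{i, j}})"
    unfolding card_descent_class_Pow_doubleton[OF assms, symmetric]
    by (subst card_descent_class_sum) (use assms in \<open>simp_all add: Pow_insert doubleton_eq_iff\<close>)
  moreover have "int (card (descent_class A {{i}})) = int (card A choose i) - 1"
    "int (card (descent_class A {{j}})) = int (card A choose j) - 1"
    using assms by (simp_all add: card_descent_class_singleton)
  ultimately show ?thesis
    by (simp add: card_descent_class_empty[OF assms(1)] flip: of_nat_mult)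
qed

lemma card_descent_class_symmetric:
  assumes "d < card A"
  shows "card (descent_class A {D. card D = card A - 1 - d}) =
    card (descent_class A {D. card D = d})"
proof (rule bij_betw_same_card[of rev], rule bij_betw_byWitness[where f' = rev])
  have rev_mem: "rev xs \<in> descent_class A {D. card D = card A - 1 - e}"
    if "xs \<in> descent_class A {D. card D = e}" for xs e
  proof -
    have "distinct xs" "set xs = A" "card (list_descents xs) = e"
      using that by (auto simp: descent_class_def permutations_of_set_def)
    moreover from this have "length xs = card A" by (metis distinct_card)
    ultimately show ?thesis
      by (simp add: descent_class_def permutations_of_set_def card_list_descents_rev)
  qed
  show "rev ` descent_class A {D. card D = d} \<subseteq> descent_class A {D. card D = card A - 1 - d}"
    using rev_mem by blast
  show "rev ` descent_class A {D. card D = card A - 1 - d} \<subseteq> descent_class A {D. card D = d}"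
    using rev_mem[where e = "card A - 1 - d"] assms by (simp add: image_subset_iff)
qed simp_all

section \<open>Permutations with at most two descents\<close>

lemma card_no_descents:
  assumes "finite A"
  shows "card (descent_class A {D. card D = 0}) = 1"
proof -
  have "descent_class A {D. card D = 0} = descent_class A {{}}"
    by (rule descent_class_cong) (auto dest: finite_subset)
  then show ?thesis by (simp add: card_descent_class_empty[OF assms])
qed

lemma card_one_descent:
  assumes "finite A"
  shows "int (card (descent_class A {D. card D = 1})) = 2 ^ card A - int (card A) - 1"
proof -
  have "descent_class A {D. card D = 1} = descent_class A ((\<lambda>k. {k}) ` {..card A})"
  proof (rule descent_class_cong)
    fix D :: "nat set" assume "D \<subseteq> {1..<card A}"
    then show "D \<in> {D. card D = 1} \<longleftrightarrow> D \<in> (\<lambda>k. {k}) ` {..card A}"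
      by (force simp: card_1_singleton_iff)
  qed
  then have "card (descent_class A {D. card D = 1}) = (\<Sum>k\<le>card A. card (descent_class A {{k}}))"
    by (simp only: card_descent_class_image finite_atMost inj_singleton)
  then have "int (card (descent_class A {D. card D = 1})) =
      (\<Sum>k\<le>card A. int (card A choose k) - 1)"
    by (simp add: card_descent_class_singleton[OF assms])
  also have "\<dots> = int (\<Sum>k\<le>card A. card A choose k) - int (card A) - 1"
    by (simp add: sum_subtractf)
  finally show ?thesis by (simp add: choose_row_sum)
qed

lemma card_two_descents:
  assumes "finite A"
  shows "int (card (descent_class A {D. card D = 2})) =
    3 ^ card A - (int (card A) + 1) * 2 ^ card A + int (Suc (card A) choose 2)"
proof -
  let ?n = "card A"
  have "descent_class A {D. card D = 2} = descent_class A {D. D \<subseteq> {..?n} \<and> card D = 2}"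
    by (rule descent_class_cong) auto
  moreover have "inj_on (\<lambda>(j, i). {i, j}) (SIGMA j:{..?n}. {..<j})"
    by (auto simp: inj_on_def doubleton_eq_iff)
  ultimately have "card (descent_class A {D. card D = 2}) =
      (\<Sum>(j, i)\<in>(SIGMA j:{..?n}. {..<j}). card (descent_class A {{i, j}}))"
    by (simp add: doubletons_atMost_eq card_descent_class_image case_prod_unfold)
  then have "int (card (descent_class A {D. card D = 2})) =
      (\<Sum>j\<le>?n. \<Sum>i<j. int (card (descent_class A {{i, j}})))"
    by (simp add: sum.Sigma case_prod_unfold)
  also have "\<dots> = (\<Sum>j\<le>?n. \<Sum>i<j. int (?n choose j) * int (j choose i) -
      (int (?n choose i) + int (?n choose j)) + 1)"
    by (intro sum.cong) (simp_all add: card_descent_class_doubleton[OF assms])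
  also have "\<dots> = (\<Sum>j\<le>?n. int (?n choose j) * (\<Sum>i<j. int (j choose i))) -
      (\<Sum>j\<le>?n. \<Sum>i<j. int (?n choose i) + int (?n choose j)) + (\<Sum>j\<le>?n. int j)"
    by (simp add: sum.distrib sum_subtractf sum_distrib_left)
  also have "(\<Sum>j\<le>?n. int (?n choose j) * (\<Sum>i<j. int (j choose i))) = 3 ^ ?n - 2 ^ ?n"
    by (rule sum_choose_choose_less)
  also have "(\<Sum>j\<le>?n. \<Sum>i<j. int (?n choose i) + int (?n choose j)) = int ?n * 2 ^ ?n"
    using choose_row_sum[of ?n] by (simp add: sum_pairs_less flip: of_nat_sum)
  also have "(\<Sum>j\<le>?n. int j) = int (Suc ?n choose 2)"
    using sum_choose_upper[of 1 ?n] by (simp add: numeral_2_eq_2 flip: of_nat_sum)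
  finally show ?thesis by (simp add: algebra_simps)
qed

lemma card_two_descents_including_1:
  assumes "finite A" "0 < card A"
  shows "int (card (descent_class A {D. card D = 2 \<and> 1 \<in> D})) =
    (int (card A) - 2) * (2 ^ (card A - 1) - int (card A))"
proof -
  let ?n = "card A"
  have "descent_class A {D. card D = 2 \<and> 1 \<in> D} = descent_class A ((\<lambda>j. {1, j}) ` {2..?n})"
  proof (rule descent_class_cong)
    fix D assume D_subset: "D \<subseteq> {1..<?n}"
    show "D \<in> {D. card D = 2 \<and> 1 \<in> D} \<longleftrightarrow> D \<in> (\<lambda>j. {1, j}) ` {2..?n}"
    proof
      assume "D \<in> {D. card D = 2 \<and> 1 \<in> D}"
      then obtain j where "D = {1, j}" "j \<noteq> 1" by (auto simp: card_2_iff)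
      with D_subset show "D \<in> (\<lambda>j. {1, j}) ` {2..?n}" by auto
    qed auto
  qed
  moreover have "inj_on (\<lambda>j. {1, j}) {2..?n}" by (auto simp: inj_on_def doubleton_eq_iff)
  ultimately have "int (card (descent_class A {D. card D = 2 \<and> 1 \<in> D})) =
      (\<Sum>j = 2..?n. int (card (descent_class A {{1, j}})))"
    by (simp only: card_descent_class_image finite_atLeastAtMost of_nat_sum)
  also have "\<dots> = (\<Sum>j = 2..?n. int (j * (?n choose j)) - int (?n choose j) - (int ?n - 1))"
    by (intro sum.cong) (simp_all add: card_descent_class_doubleton[OF assms(1)])
  also have "\<dots> =
      (\<Sum>j\<le>?n. int (j * (?n choose j)) - int (?n choose j) - (int ?n - 1)) + 2 * int ?n - 1"
  proof -
    have "{..?n} = insert 0 (insert 1 {2..?n})" using assms(2) by auto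
    then show ?thesis by simp
  qed
  also have "\<dots> = int ?n * 2 ^ (?n - 1) - 2 ^ ?n - (int ?n - 1) * (int ?n + 1) + 2 * int ?n - 1"
    unfolding sum_subtractf of_nat_sum[symmetric] choose_linear_sum choose_row_sum
    by (simp add: algebra_simps)
  also have "\<dots> = (int ?n - 2) * (2 ^ (?n - 1) - int ?n)"
    using power_minus_mult[OF assms(2), of "2 :: int"] by (simp add: algebra_simps)
  finally show ?thesis .
qed

section \<open>Ballot permutations with two descents\<close>

lemma descents_eq_list_descents: "descents n \<pi> = list_descents (map \<pi> [1..<Suc n])"
  by (auto simp: descents_def list_descents_def simp del: upt_Suc)

lemma bij_betw_permutes_permutations_of_set:
  "bij_betw (\<lambda>\<pi>. map \<pi> [1..<Suc n]) {\<pi>. \<pi> permutes {1..n}} (permutations_of_set {1..n})"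
    (is "bij_betw ?f ?P _")
proof -
  have inj: "inj_on ?f ?P"
  proof (rule inj_onI, rule ext)
    fix \<pi> \<sigma> x assume "\<pi> \<in> ?P" "\<sigma> \<in> ?P" "?f \<pi> = ?f \<sigma>"
    then show "\<pi> x = \<sigma> x"
      by (cases "x \<in> {1..n}") (auto simp: permutes_not_in simp del: upt_Suc)
  qed
  have "[1..<Suc n] \<in> permutations_of_set {1..n}"
    by (rule permutations_of_setI) auto
  then have "?f ` ?P \<subseteq> permutations_of_set {1..n}"
    using permutations_of_set_image_permutes by blast
  moreover have "card (?f ` ?P) = card (permutations_of_set {1..n})"
    unfolding card_image[OF inj] by (simp add: card_permutations[OF refl])
  ultimately have "?f ` ?P = permutations_of_set {1..n}"
    by (intro card_subset_eq) auto
  with inj show ?thesis by (simp add: bij_betw_def)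
qed

lemma card_permutes_descents:
  "card {\<pi>. \<pi> permutes {1..n} \<and> descents n \<pi> \<in> \<D>} = card (descent_class {1..n} \<D>)"
proof -
  have "bij_betw (\<lambda>\<pi>. map \<pi> [1..<Suc n]) {\<pi> \<in> {\<pi>. \<pi> permutes {1..n}}. descents n \<pi> \<in> \<D>}
      (descent_class {1..n} \<D>)"
    unfolding descent_class_def
    by (rule bij_betw_Collect[OF bij_betw_permutes_permutations_of_set])
       (simp only: descents_eq_list_descents)
  then show ?thesis by (simp add: bij_betw_same_card)
qed

lemma eulerian_eq_card_descent_class: "eulerian n d = card (descent_class {1..n} {D. card D = d})"
  using card_permutes_descents[of n "{D. card D = d}"] by (simp add: eulerian_def)

lemma ballot_iff_descents:
  assumes "\<pi> permutes {1..n}"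
  shows "ballot n \<pi> \<longleftrightarrow> (\<forall>k\<in>{1..<n}. 2 * card (descents n \<pi> \<inter> {1..k}) \<le> k)"
proof -
  have "card (ascents n \<pi> \<inter> {1..k}) + card (descents n \<pi> \<inter> {1..k}) = k" if "k \<in> {1..<n}" for k
  proof -
    have "\<pi> i \<noteq> \<pi> (i + 1)" for i
      using permutes_inj[OF assms] by (metis add_cancel_right_right injD zero_neq_one)
    then have "(ascents n \<pi> \<inter> {1..k}) \<union> (descents n \<pi> \<inter> {1..k}) = {1..k}"
      using that by (force simp: ascents_def descents_def neq_iff)
    moreover have "(ascents n \<pi> \<inter> {1..k}) \<inter> (descents n \<pi> \<inter> {1..k}) = {}"
      by (auto simp: ascents_def descents_def)
    ultimately show ?thesis
      using card_Un_disjoint[of "ascents n \<pi> \<inter> {1..k}" "descents n \<pi> \<inter> {1..k}"] by simp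
  qed
  then have "card (descents n \<pi> \<inter> {1..k}) \<le> card (ascents n \<pi> \<inter> {1..k}) \<longleftrightarrow>
      2 * card (descents n \<pi> \<inter> {1..k}) \<le> k" if "k \<in> {1..<n}" for k
    using that by fastforce
  then show ?thesis unfolding ballot_def by (intro ball_cong refl)
qed

lemma ballot_two_descents_iff:
  assumes "\<pi> permutes {1..n}" "card (descents n \<pi>) = 2"
  shows "ballot n \<pi> \<longleftrightarrow> 1 \<notin> descents n \<pi> \<and> descents n \<pi> \<noteq> {2, 3}"
proof -
  obtain i j where descents_eq: "descents n \<pi> = {i, j}" and "i < j"
    using card_2_less_obtains[OF assms(2)] .
  then have bounds: "1 \<le> i" "j < n" by (auto simp: descents_def)
  have card_prefix:
    "card (descents n \<pi> \<inter> {1..k}) = (if k < i then 0 else if k < j then 1 else 2)" for k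
  proof -
    have "descents n \<pi> \<inter> {1..k} = (if k < i then {} else if k < j then {i} else {i, j})"
      using descents_eq \<open>i < j\<close> bounds by auto
    then show ?thesis using \<open>i < j\<close> by simp
  qed
  have "ballot n \<pi> \<longleftrightarrow> 2 \<le> i \<and> 4 \<le> j"
  proof
    assume "ballot n \<pi>"
    then have "2 * card (descents n \<pi> \<inter> {1..i}) \<le> i" "2 * card (descents n \<pi> \<inter> {1..j}) \<le> j"
      using \<open>i < j\<close> bounds by (auto simp: ballot_iff_descents[OF assms(1)])
    then show "2 \<le> i \<and> 4 \<le> j" using \<open>i < j\<close> bounds(1) unfolding card_prefix by auto
  next
    assume "2 \<le> i \<and> 4 \<le> j"
    then show "ballot n \<pi>"
      unfolding ballot_iff_descents[OF assms(1)] card_prefix by auto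
  qed
  also have "\<dots> \<longleftrightarrow> 1 \<notin> descents n \<pi> \<and> descents n \<pi> \<noteq> {2, 3}"
    unfolding descents_eq doubleton_eq_iff using \<open>i < j\<close> bounds(1) by auto
  finally show ?thesis .
qed

lemma card_descent_class_2_3:
  assumes "finite A" "2 \<le> card A"
  shows "int (card (descent_class A {{2, 3}})) =
    2 * int (card A choose 3) - int (card A choose 2) + 1"
proof (cases "card A = 2")
  case True
  have "descent_class A {{2, 3}} = descent_class A {}"
  proof (rule descent_class_cong)
    fix D assume "D \<subseteq> {1..<card A}"
    with True have "3 \<notin> D" by auto
    then show "D \<in> {{2, 3}} \<longleftrightarrow> D \<in> {}" by blast
  qed
  also have "\<dots> = {}" by (simp add: descent_class_def)
  finally show ?thesis using True by simp
next
  case False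
  moreover have "3 choose 2 = (3 :: nat)" by (simp add: numeral_3_eq_3 numeral_2_eq_2)
  ultimately show ?thesis using assms card_descent_class_doubleton[of A 2 3] by simp
qed

lemma ballot_number_2:
  assumes "2 \<le> n"
  shows "int (ballot_number n 2) = 3 ^ n - 3 * int n * 2 ^ (n - 1) + 4 * int (n choose 2)
    - 2 * int (n choose 3) - 1"
proof -
  let ?ballot = "{D :: nat set. card D = 2 \<and> 1 \<notin> D \<and> D \<noteq> {2, 3}}"
    and ?initial = "{D :: nat set. card D = 2 \<and> 1 \<in> D}"
  let ?count = "\<lambda>\<D>. int (card (descent_class {1..n} \<D>))"
  have "{\<pi>. \<pi> permutes {1..n} \<and> ballot n \<pi> \<and> card (descents n \<pi>) = 2} =
      {\<pi>. \<pi> permutes {1..n} \<and> descents n \<pi> \<in> ?ballot}"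
    using ballot_two_descents_iff[of _ n] by blast
  then have "ballot_number n 2 = card (descent_class {1..n} ?ballot)"
    unfolding ballot_number_def card_permutes_descents[symmetric] by (rule arg_cong)
  also have "int \<dots> = ?count {D. card D = 2} - ?count ?initial - ?count {{2, 3}}"
  proof -
    have "{D :: nat set. card D = 2} = (?ballot \<union> ?initial) \<union> {{2, 3}}" by auto
    moreover have "?ballot \<inter> ?initial = {}" "(?ballot \<union> ?initial) \<inter> {{2, 3}} = {}" by auto
    ultimately show ?thesis by (simp only: card_descent_class_disjoint_Un of_nat_add)
  qed
  also have "\<dots> = (3 ^ n - (int n + 1) * 2 ^ n + int (Suc n choose 2)) -
      (int n - 2) * (2 ^ (n - 1) - int n) - (2 * int (n choose 3) - int (n choose 2) + 1)"
    using assms card_two_descents[of "{1..n}"] card_two_descents_including_1[of "{1..n}"]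
      card_descent_class_2_3[of "{1..n}"] by simp
  also have "2 ^ n = 2 ^ (n - 1) * (2 :: int)"
    by (rule power_minus_mult[symmetric]) (use assms in simp)
  also have "Suc n choose 2 = n + (n choose 2)"
    by (simp add: numeral_2_eq_2)
  finally show ?thesis
    using double_int_choose_two[of n] by (simp add: algebra_simps)
qed

lemma eulerian_2: "int (eulerian n 2) = 3 ^ n - (int n + 1) * 2 ^ n + int (Suc n choose 2)"
  using card_two_descents[of "{1..n}"] by (simp add: eulerian_eq_card_descent_class)

section \<open>Permutations as sets of disjoint cycles\<close>

definition canonical_cycle :: "'a::linorder list \<Rightarrow> bool" where
  "canonical_cycle c \<longleftrightarrow> c \<noteq> [] \<and> distinct c \<and> (\<forall>x\<in>set c. hd c \<le> x)"

abbreviation disjoint_cycles :: "'a list set \<Rightarrow> bool" where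
  "disjoint_cycles K \<equiv> pairwise (\<lambda>c d. disjnt (set c) (set d)) K"

lemma map_support:
  assumes "permutation \<pi>"
  shows "map \<pi> (support \<pi> x) = rotate1 (support \<pi> x)"
proof -
  have "map \<pi> (support \<pi> x) = map (cycle_of_list (support \<pi> x)) (support \<pi> x)"
    using cycle_restrict[OF assms] by (intro map_cong refl)
  also have "\<dots> = rotate1 (support \<pi> x)"
    using cyclic_rotation[OF cycle_of_permutation[OF assms], of 1] by simp
  finally show ?thesis .
qed

lemma support_hd_eq:
  assumes "c \<noteq> []" "distinct c" "map \<pi> c = rotate1 c"
  shows "support \<pi> (hd c) = c"
proof -
  have funpow_map: "map (\<pi> ^^ i) c = rotate i c" for i
  proof (induction i)
    case (Suc i)
    have "map (\<pi> ^^ Suc i) c = map \<pi> (rotate i c)"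
      by (simp add: o_def flip: Suc)
    also have "\<dots> = rotate (Suc i) c"
      by (simp add: assms(3) rotate1_rotate_swap flip: rotate_map)
    finally show ?case .
  qed simp
  have funpow_hd: "(\<pi> ^^ i) (hd c) = c ! (i mod length c)" for i
    using arg_cong[OF funpow_map[of i], of hd] assms(1) by (simp add: hd_map hd_rotate_conv_nth)
  have length_pos: "0 < length c" using assms(1) by simp
  have "least_power \<pi> (hd c) = length c"
    unfolding least_power_def
  proof (rule Least_equality)
    show "(\<pi> ^^ length c) (hd c) = hd c \<and> 0 < length c"
      using assms(1) unfolding funpow_hd by (simp add: hd_conv_nth)
  next
    fix k assume period: "(\<pi> ^^ k) (hd c) = hd c \<and> 0 < k"
    then have "c ! (k mod length c) = c ! 0"
      using assms(1) unfolding funpow_hd by (simp add: hd_conv_nth)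
    then have "k mod length c = 0"
      using length_pos by (simp add: nth_eq_iff_index_eq[OF assms(2)])
    with period show "length c \<le> k" by (auto dest: dvd_imp_le)
  qed
  then show ?thesis by (intro nth_equalityI) (simp_all add: funpow_hd)
qed

lemma mem_support_self:
  assumes "permutation \<pi>"
  shows "x \<in> set (support \<pi> x)"
  unfolding support_set[OF assms] by (rule range_eqI[of _ _ 0]) simp

lemma set_support_eq:
  assumes "permutation \<pi>" "y \<in> set (support \<pi> x)"
  shows "set (support \<pi> y) = set (support \<pi> x)"
proof (rule ccontr)
  assume "set (support \<pi> y) \<noteq> set (support \<pi> x)"
  then have "set (support \<pi> y) \<inter> set (support \<pi> x) = {}"
    by (rule disjointD[OF disjoint_support[OF assms(1)] rangeI rangeI])
  then show False using mem_support_self[OF assms(1), of y] assms(2) by blast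
qed

lemma set_support_subset:
  assumes "\<pi> permutes A" "x \<in> A"
  shows "set (support \<pi> x) \<subseteq> A"
  using permutes_in_image[OF permutes_funpow[OF assms(1)]] assms(2) by auto

lemma perm_cycles_iff:
  assumes "\<pi> permutes {1..n}"
  shows "c \<in> perm_cycles n \<pi> \<longleftrightarrow> canonical_cycle c \<and> set c \<subseteq> {1..n} \<and> map \<pi> c = rotate1 c"
proof
  note perm = permutes_imp_permutation[OF finite_atLeastAtMost assms]
  assume "c \<in> perm_cycles n \<pi>"
  then obtain x where c_eq: "c = support \<pi> x" and x_min: "x \<in> {1..n}" "\<forall>y\<in>set c. x \<le> y"
    unfolding perm_cycles_def by blast
  have "c \<noteq> []" "hd c = x"
    using least_power_of_permutation(2)[OF perm, of x] by (simp_all add: c_eq hd_map)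
  moreover have "distinct c" "map \<pi> c = rotate1 c"
    unfolding c_eq by (rule cycle_of_permutation[OF perm]) (rule map_support[OF perm])
  moreover have "set c \<subseteq> {1..n}"
    unfolding c_eq by (rule set_support_subset[OF assms x_min(1)])
  ultimately show "canonical_cycle c \<and> set c \<subseteq> {1..n} \<and> map \<pi> c = rotate1 c"
    using x_min(2) by (simp add: canonical_cycle_def)
next
  assume cycle: "canonical_cycle c \<and> set c \<subseteq> {1..n} \<and> map \<pi> c = rotate1 c"
  then have "support \<pi> (hd c) = c" "hd c \<in> set c" "\<forall>x\<in>set c. hd c \<le> x"
    by (auto simp: canonical_cycle_def intro: support_hd_eq)
  with cycle show "c \<in> perm_cycles n \<pi>"
    unfolding perm_cycles_def by (intro CollectI exI[of _ "hd c"]) auto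
qed

lemma ex_perm_cycle:
  assumes "\<pi> permutes {1..n}" "x \<in> {1..n}"
  obtains c where "c \<in> perm_cycles n \<pi>" "x \<in> set c"
proof -
  note perm = permutes_imp_permutation[OF finite_atLeastAtMost assms(1)]
  define m where "m = Min (set (support \<pi> x))"
  have m_mem: "m \<in> set (support \<pi> x)"
    unfolding m_def using mem_support_self[OF perm, of x] by (intro Min_in) auto
  have same_set: "set (support \<pi> m) = set (support \<pi> x)" by (rule set_support_eq[OF perm m_mem])
  have "m \<in> {1..n}" using m_mem set_support_subset[OF assms] by blast
  moreover have "\<forall>y\<in>set (support \<pi> m). m \<le> y" unfolding same_set unfolding m_def by simp
  ultimately have "support \<pi> m \<in> perm_cycles n \<pi>" unfolding perm_cycles_def by blast
  moreover have "x \<in> set (support \<pi> m)" unfolding same_set by (rule mem_support_self[OF perm])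
  ultimately show ?thesis by (rule that)
qed

lemma disjoint_perm_cycles:
  assumes "\<pi> permutes {1..n}"
  shows "disjoint_cycles (perm_cycles n \<pi>)"
proof (rule pairwiseI, rule ccontr)
  note perm = permutes_imp_permutation[OF finite_atLeastAtMost assms]
  fix c d
  assume "c \<in> perm_cycles n \<pi>" "d \<in> perm_cycles n \<pi>" "c \<noteq> d"
    and meet: "\<not> disjnt (set c) (set d)"
  then obtain x y where supports: "c = support \<pi> x" "d = support \<pi> y"
    and minimal: "\<forall>z\<in>set c. x \<le> z" "\<forall>z\<in>set d. y \<le> z"
    unfolding perm_cycles_def by blast
  obtain z where "z \<in> set c" "z \<in> set d" using meet by (auto simp: disjnt_iff)
  then have "set c = set d"
    using set_support_eq[OF perm, of z x] set_support_eq[OF perm, of z y] supports by simp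
  moreover have "x \<in> set c" "y \<in> set d"
    unfolding supports by (rule mem_support_self[OF perm])+
  ultimately have "x = y" using minimal by (simp add: antisym)
  with supports \<open>c \<noteq> d\<close> show False by simp
qed

lemma finite_perm_cycles: "finite (perm_cycles n \<pi>)"
proof -
  have "perm_cycles n \<pi> \<subseteq> support \<pi> ` {1..n}" unfolding perm_cycles_def by blast
  then show ?thesis by (rule finite_subset) simp
qed

definition nontrivial_cycles :: "nat \<Rightarrow> (nat \<Rightarrow> nat) \<Rightarrow> nat list set" where
  "nontrivial_cycles n \<pi> = {c \<in> perm_cycles n \<pi>. 2 \<le> length c}"

definition disjoint_cycle_sets :: "'a::linorder set \<Rightarrow> 'a list set set" where
  "disjoint_cycle_sets U = {K. (\<forall>c\<in>K. canonical_cycle c \<and> set c \<subseteq> U \<and> 2 \<le> length c) \<and>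
     disjoint_cycles K}"

lemma finite_disjoint_cycle_set:
  assumes "K \<in> disjoint_cycle_sets U" "finite U"
  shows "finite K"
proof (rule finite_subset)
  show "K \<subseteq> {c. set c \<subseteq> U \<and> distinct c}"
    using assms(1) by (auto simp: disjoint_cycle_sets_def canonical_cycle_def)
qed (rule finite_subset_distinct[OF assms(2)])

lemma nontrivial_cycles_in_disjoint_cycle_sets:
  assumes "\<pi> permutes {1..n}"
  shows "nontrivial_cycles n \<pi> \<in> disjoint_cycle_sets {1..n}"
proof -
  have "nontrivial_cycles n \<pi> \<subseteq> perm_cycles n \<pi>" by (auto simp: nontrivial_cycles_def)
  then have "disjoint_cycles (nontrivial_cycles n \<pi>)"
    by (rule pairwise_subset[OF disjoint_perm_cycles[OF assms]])
  then show ?thesis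
    by (auto simp: disjoint_cycle_sets_def nontrivial_cycles_def perm_cycles_iff[OF assms])
qed

lemma fixed_on_cycle_iff:
  assumes "distinct c" "map \<pi> c = rotate1 c" "x \<in> set c"
  shows "\<pi> x = x \<longleftrightarrow> length c < 2"
proof -
  obtain i where index: "i < length c" "x = c ! i" using assms(3) by (auto simp: in_set_conv_nth)
  have "\<pi> x = c ! (Suc i mod length c)"
    using arg_cong[OF assms(2), of "\<lambda>d. d ! i"] index by (simp add: nth_rotate1)
  moreover have "Suc i mod length c < length c" using index(1) by (intro mod_less_divisor) linarith
  ultimately have "\<pi> x = x \<longleftrightarrow> Suc i mod length c = i"
    using index nth_eq_iff_index_eq[OF assms(1), of "Suc i mod length c" i] by simp
  also have "\<dots> \<longleftrightarrow> length c < 2"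
  proof (cases "Suc i = length c")
    case True
    then have "Suc i mod length c = 0" by simp
    with True show ?thesis by linarith
  next
    case False
    then have "Suc i < length c" using index(1) by linarith
    then show ?thesis by simp
  qed
  finally show ?thesis .
qed

lemma fixed_iff_notin_nontrivial_cycles:
  assumes "\<pi> permutes {1..n}"
  shows "\<pi> x = x \<longleftrightarrow> x \<notin> (\<Union>c\<in>nontrivial_cycles n \<pi>. set c)"
proof (cases "x \<in> {1..n}")
  case True
  then obtain c where cycle_x: "c \<in> perm_cycles n \<pi>" "x \<in> set c"
    by (rule ex_perm_cycle[OF assms])
  then have "\<pi> x = x \<longleftrightarrow> length c < 2"
    by (intro fixed_on_cycle_iff) (auto simp: perm_cycles_iff[OF assms] canonical_cycle_def)
  also have "\<dots> \<longleftrightarrow> c \<notin> nontrivial_cycles n \<pi>"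
    using cycle_x(1) by (auto simp: nontrivial_cycles_def)
  also have "\<dots> \<longleftrightarrow> x \<notin> (\<Union>c\<in>nontrivial_cycles n \<pi>. set c)"
  proof -
    have "d = c" if "d \<in> nontrivial_cycles n \<pi>" "x \<in> set d" for d
      using that cycle_x disjoint_perm_cycles[OF assms] unfolding nontrivial_cycles_def
      by (metis (no_types, lifting) disjnt_iff mem_Collect_eq pairwiseD)
    then show ?thesis using cycle_x(2) by blast
  qed
  finally show ?thesis .
next
  case False
  have "set c \<subseteq> {1..n}" if "c \<in> nontrivial_cycles n \<pi>" for c
    using that by (simp add: nontrivial_cycles_def perm_cycles_iff[OF assms])
  with False have "x \<notin> (\<Union>c\<in>nontrivial_cycles n \<pi>. set c)" by blast
  then show ?thesis using permutes_not_in[OF assms False] by blast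
qed

lemma inj_on_nontrivial_cycles: "inj_on (nontrivial_cycles n) {\<pi>. \<pi> permutes {1..n}}"
proof (rule inj_onI, rule ext)
  fix \<pi> \<sigma> x
  assume "\<pi> \<in> {\<pi>. \<pi> permutes {1..n}}" "\<sigma> \<in> {\<pi>. \<pi> permutes {1..n}}"
    and same_cycles: "nontrivial_cycles n \<pi> = nontrivial_cycles n \<sigma>"
  then have \<pi>_permutes: "\<pi> permutes {1..n}" and \<sigma>_permutes: "\<sigma> permutes {1..n}" by auto
  show "\<pi> x = \<sigma> x"
  proof (cases "\<exists>c\<in>nontrivial_cycles n \<pi>. x \<in> set c")
    case True
    then obtain c where "c \<in> nontrivial_cycles n \<pi>" "c \<in> nontrivial_cycles n \<sigma>" "x \<in> set c"
      using same_cycles by auto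
    then have "map \<pi> c = map \<sigma> c" "x \<in> set c"
      by (simp_all add: nontrivial_cycles_def perm_cycles_iff[OF \<pi>_permutes]
          perm_cycles_iff[OF \<sigma>_permutes])
    then show ?thesis by simp
  next
    case False
    then show ?thesis
      using fixed_iff_notin_nontrivial_cycles[OF \<pi>_permutes, of x]
        fixed_iff_notin_nontrivial_cycles[OF \<sigma>_permutes, of x] same_cycles by auto
  qed
qed

lemma ex_permutes_with_cycles:
  assumes "finite K" "\<forall>c\<in>K. distinct c" "disjoint_cycles K"
  shows "\<exists>\<pi>. \<pi> permutes (\<Union>c\<in>K. set c) \<and> (\<forall>c\<in>K. map \<pi> c = rotate1 c)"
  using assms
proof (induction K)
  case empty
  then show ?case by (intro exI[of _ id]) (auto simp: permutes_id)
next
  case (insert c K)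
  let ?U = "\<Union>d\<in>K. set d"
  obtain \<pi> where \<pi>_permutes: "\<pi> permutes ?U" and \<pi>_cycles: "\<forall>d\<in>K. map \<pi> d = rotate1 d"
    using insert by (auto simp: pairwise_insert)
  have disj: "set c \<inter> ?U = {}"
    using insert.prems(2) insert.hyps(2) by (auto simp: pairwise_insert disjnt_iff)
  let ?\<sigma> = "cycle_of_list c \<circ> \<pi>"
  have "?\<sigma> permutes (\<Union>d\<in>insert c K. set d)"
    by (intro permutes_compose permutes_subset[OF \<pi>_permutes] permutes_subset[OF cycle_permutes])
       auto
  moreover have "map ?\<sigma> c = rotate1 c"
  proof -
    have "map \<pi> c = c"
      using disj by (intro map_idI permutes_not_in[OF \<pi>_permutes]) blast
    then have "map ?\<sigma> c = map (cycle_of_list c) c" by (metis map_map)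
    also have "\<dots> = rotate1 c" using cyclic_rotation[of c 1] insert.prems(1) by simp
    finally show ?thesis .
  qed
  moreover have "map ?\<sigma> d = rotate1 d" if "d \<in> K" for d
  proof -
    have "map (cycle_of_list c) (rotate1 d) = rotate1 d"
      using disj that by (intro map_idI id_outside_supp) auto
    then show ?thesis using \<pi>_cycles that by (simp flip: map_map)
  qed
  ultimately show ?case by blast
qed

lemma ex_permutes_nontrivial_cycles:
  assumes "K \<in> disjoint_cycle_sets {1..n}"
  shows "\<exists>\<pi>. \<pi> permutes {1..n} \<and> nontrivial_cycles n \<pi> = K"
proof -
  let ?U = "\<Union>c\<in>K. set c"
  have cycles: "canonical_cycle c" "set c \<subseteq> {1..n}" "2 \<le> length c" if "c \<in> K" for c
    using assms that by (auto simp: disjoint_cycle_sets_def)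
  have "\<forall>c\<in>K. distinct c" "disjoint_cycles K"
    using assms by (auto simp: disjoint_cycle_sets_def canonical_cycle_def)
  then obtain \<pi> where permutes_U: "\<pi> permutes ?U" and \<pi>_cycles: "\<forall>c\<in>K. map \<pi> c = rotate1 c"
    using ex_permutes_with_cycles[OF finite_disjoint_cycle_set[OF assms]] by auto
  then have perm: "\<pi> permutes {1..n}"
    using cycles(2) by (intro permutes_subset[OF permutes_U]) auto
  have K_subset: "K \<subseteq> nontrivial_cycles n \<pi>"
    using cycles \<pi>_cycles by (auto simp: nontrivial_cycles_def perm_cycles_iff[OF perm])
  have "c \<in> K" if "c \<in> nontrivial_cycles n \<pi>" for c
  proof -
    have "hd c \<in> set c" using that by (intro hd_in_set) (auto simp: nontrivial_cycles_def)
    then have "\<pi> (hd c) \<noteq> hd c" using that fixed_iff_notin_nontrivial_cycles[OF perm] by blast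
    then obtain d where "d \<in> K" "hd c \<in> set d" using permutes_not_in[OF permutes_U] by blast
    then have "\<not> disjnt (set c) (set d)" using \<open>hd c \<in> set c\<close> by (auto simp: disjnt_iff)
    moreover have "disjoint_cycles (nontrivial_cycles n \<pi>)"
      using nontrivial_cycles_in_disjoint_cycle_sets[OF perm] by (simp add: disjoint_cycle_sets_def)
    ultimately have "c = d" using that \<open>d \<in> K\<close> K_subset by (meson pairwiseD subsetD)
    with \<open>d \<in> K\<close> show ?thesis by simp
  qed
  with K_subset perm show ?thesis by blast
qed

theorem bij_betw_nontrivial_cycles:
  "bij_betw (nontrivial_cycles n) {\<pi>. \<pi> permutes {1..n}} (disjoint_cycle_sets {1..n})"
  by (rule bij_betw_imageI[OF inj_on_nontrivial_cycles])
     (use nontrivial_cycles_in_disjoint_cycle_sets ex_permutes_nontrivial_cycles in blast)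

section \<open>Cycles with a given number of cyclic descents\<close>

lemma cA_add_cD: "cA c + cD c = length c"
proof -
  let ?up = "{i \<in> {..<length c}. c ! i \<le> c ! (Suc i mod length c)}"
  let ?down = "{i \<in> {..<length c}. c ! i > c ! (Suc i mod length c)}"
  have "card ?up + card ?down = card (?up \<union> ?down)"
    by (rule card_Un_disjoint[symmetric]) auto
  also have "?up \<union> ?down = {..<length c}" by auto
  finally show ?thesis by (simp add: cA_def cD_def)
qed

lemma double_cycle_M_le: "2 * cycle_M c \<le> length c"
  using cA_add_cD[of c] by (simp add: cycle_M_def)

lemma cD_Cons_less:
  assumes "xs \<noteq> []" "\<And>x. x \<in> set xs \<Longrightarrow> m < x"
  shows "cD (m # xs) = Suc (card (list_descents xs))"
proof -
  let ?c = "m # xs" and ?l = "length xs"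
  have "i < length ?c \<and> ?c ! i > ?c ! (Suc i mod length ?c) \<longleftrightarrow> i \<in> insert ?l (list_descents xs)"
    for i
  proof -
    consider (inner) "i < ?l" | (last) "i = ?l" | (outside) "?l < i" by linarith
    then show ?thesis
    proof cases
      case inner
      then have "i < length ?c \<and> ?c ! i > ?c ! (Suc i mod length ?c) \<longleftrightarrow>
          Suc i \<in> list_descents ?c"
        by (simp add: list_descents_def)
      then show ?thesis using inner by (auto simp: list_descents_Cons_less assms(2))
    next
      case last
      moreover have "?c ! ?l \<in> set xs" using assms(1) by (cases ?l) auto
      ultimately show ?thesis using assms(2) by simp
    next
      case outside
      then show ?thesis by (auto simp: list_descents_def)
    qed
  qed
  then have "cD ?c = card (insert ?l (list_descents xs))"
    unfolding cD_def by (intro arg_cong[of _ _ card]) auto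
  then show ?thesis by (simp add: list_descents_def)
qed

lemma cycle_M_Cons_less:
  assumes "xs \<noteq> []" "\<And>x. x \<in> set xs \<Longrightarrow> m < x"
  shows "cycle_M (m # xs) =
    min (Suc (card (list_descents xs))) (length xs - card (list_descents xs))"
  using cA_add_cD[of "m # xs"] by (simp add: cycle_M_def cD_Cons_less[OF assms] min.commute)

lemma cycle_M_Cons_eq_iff:
  assumes "\<And>x. x \<in> set xs \<Longrightarrow> m < x" "0 < k" "2 * k \<le> length xs"
  shows "cycle_M (m # xs) = k \<longleftrightarrow>
    card (list_descents xs) = k - 1 \<or> card (list_descents xs) = length xs - 1 - (k - 1)"
proof -
  have "xs \<noteq> []" using assms(2,3) by auto
  then show ?thesis
    using assms(2,3) card_list_descents_less[of xs]
    by (auto simp: cycle_M_Cons_less[OF _ assms(1)] min_def)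
qed

lemma canonical_cycle_Cons: "canonical_cycle (m # xs) \<longleftrightarrow> distinct xs \<and> (\<forall>x\<in>set xs. m < x)"
  by (auto simp: canonical_cycle_def order_less_le)

lemma cycle_M_pos:
  assumes "canonical_cycle c" "2 \<le> length c"
  shows "0 < cycle_M c"
proof (cases c)
  case (Cons m xs)
  then have "xs \<noteq> []" using assms(2) by auto
  then show ?thesis
    using Cons assms(1) cycle_M_Cons_less[of xs m] card_list_descents_less[of xs]
    by (simp add: canonical_cycle_Cons)
qed (use assms(2) in simp)

lemma canonical_cycles_eq_image:
  assumes "finite S" "S \<noteq> {}"
  shows "{c. canonical_cycle c \<and> set c = S} = (#) (Min S) ` permutations_of_set (S - {Min S})"
proof (intro antisym subsetI)
  fix c assume "c \<in> {c. canonical_cycle c \<and> set c = S}"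
  then obtain m xs where "c = m # xs" "distinct xs" "\<forall>x\<in>set xs. m < x" "set (m # xs) = S"
    using assms(2) by (cases c) (auto simp: canonical_cycle_Cons)
  moreover from this have "Min S = m" by (intro Min_eqI) (auto simp: less_imp_le)
  ultimately show "c \<in> (#) (Min S) ` permutations_of_set (S - {Min S})"
    by (auto intro!: imageI permutations_of_setI)
next
  fix c assume "c \<in> (#) (Min S) ` permutations_of_set (S - {Min S})"
  then obtain xs where "c = Min S # xs" "set xs = S - {Min S}" "distinct xs"
    by (auto simp: permutations_of_set_def)
  moreover have "Min S < x" if "x \<in> S - {Min S}" for x
    using that Min_le[OF assms(1), of x] by auto
  moreover have "insert (Min S) (S - {Min S}) = S" using Min_in[OF assms] by blast
  ultimately show "c \<in> {c. canonical_cycle c \<and> set c = S}"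
    by (simp add: canonical_cycle_Cons)
qed

lemma canonical_cycles_cycle_M_eq_image:
  assumes "0 < m" "2 * m < card S"
  shows "{c. canonical_cycle c \<and> set c = S \<and> cycle_M c = m} = (#) (Min S) `
    descent_class (S - {Min S})
      ({D. card D = m - 1} \<union> {D. card D = card (S - {Min S}) - 1 - (m - 1)})"
proof -
  let ?R = "S - {Min S}"
  have fin_ne: "finite S" "S \<noteq> {}" using assms(2) by (auto intro: card_ge_0_finite)
  then have card_R: "card ?R = card S - 1" by simp
  have cycle_M_iff: "cycle_M (Min S # xs) = m \<longleftrightarrow>
      list_descents xs \<in> {D. card D = m - 1} \<union> {D. card D = card ?R - 1 - (m - 1)}"
    if "xs \<in> permutations_of_set ?R" for xs
  proof -
    have "distinct xs" and set_xs: "set xs = ?R"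
      using that by (simp_all add: permutations_of_set_def)
    then have length_xs: "length xs = card ?R" by (metis distinct_card)
    have "Min S < x" if "x \<in> set xs" for x
      using that Min_le[OF fin_ne(1), of x] unfolding set_xs by auto
    moreover have "2 * m \<le> length xs" using assms(2) card_R length_xs by linarith
    ultimately show ?thesis
      using cycle_M_Cons_eq_iff[of xs "Min S" m] assms(1) unfolding length_xs by blast
  qed
  have "{c. canonical_cycle c \<and> set c = S \<and> cycle_M c = m} =
      {c \<in> (#) (Min S) ` permutations_of_set ?R. cycle_M c = m}"
    unfolding canonical_cycles_eq_image[OF fin_ne, symmetric] by blast
  also have "\<dots> = (#) (Min S) `
      descent_class ?R ({D. card D = m - 1} \<union> {D. card D = card ?R - 1 - (m - 1)})"
    unfolding descent_class_def using cycle_M_iff by blast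
  finally show ?thesis .
qed

lemma card_canonical_cycles_cycle_M:
  assumes "0 < m" "2 * m < card S"
  shows "card {c. canonical_cycle c \<and> set c = S \<and> cycle_M c = m} =
    2 * card (descent_class (S - {Min S}) {D. card D = m - 1})"
proof -
  let ?R = "S - {Min S}"
  have "finite S" "S \<noteq> {}" using assms(2) by (auto intro: card_ge_0_finite)
  then have card_R: "card ?R = card S - 1" by simp
  have "card {c. canonical_cycle c \<and> set c = S \<and> cycle_M c = m} =
      card (descent_class ?R ({D. card D = m - 1} \<union> {D. card D = card ?R - 1 - (m - 1)}))"
    unfolding canonical_cycles_cycle_M_eq_image[OF assms] by (simp add: card_image)
  also have "\<dots> = card (descent_class ?R {D. card D = m - 1}) +
      card (descent_class ?R {D. card D = card ?R - 1 - (m - 1)})"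
    by (rule card_descent_class_disjoint_Un) (use assms card_R in auto)
  also have "card (descent_class ?R {D. card D = card ?R - 1 - (m - 1)}) =
      card (descent_class ?R {D. card D = m - 1})"
    by (rule card_descent_class_symmetric) (use assms card_R in simp)
  finally show ?thesis by simp
qed

definition odd_cycles :: "nat set \<Rightarrow> nat \<Rightarrow> nat list set" where
  "odd_cycles U m = {c. canonical_cycle c \<and> set c \<subseteq> U \<and> odd (length c) \<and> cycle_M c = m}"

lemma finite_odd_cycles:
  assumes "finite U"
  shows "finite (odd_cycles U m)"
proof (rule finite_subset)
  show "odd_cycles U m \<subseteq> {c. set c \<subseteq> U \<and> distinct c}"
    by (auto simp: odd_cycles_def canonical_cycle_def)
qed (rule finite_subset_distinct[OF assms])

lemma length_odd_cycle:
  assumes "c \<in> odd_cycles U m"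
  shows "length c = card (set c)" "2 * m < length c"
proof -
  show "length c = card (set c)"
    using assms by (simp add: odd_cycles_def canonical_cycle_def distinct_card)
  have "odd (length c)" "2 * m \<le> length c"
    using assms double_cycle_M_le[of c] by (auto simp: odd_cycles_def)
  then show "2 * m < length c" by (metis dvd_triv_left le_neq_implies_less)
qed

lemma sum_odd_cycles:
  fixes f :: "nat set \<Rightarrow> 'a::semiring_1"
  assumes "finite U" "0 < m"
  shows "(\<Sum>c\<in>odd_cycles U m. f (set c)) = (\<Sum>S | S \<subseteq> U \<and> odd (card S) \<and> 2 * m < card S.
    of_nat (2 * card (descent_class (S - {Min S}) {D. card D = m - 1})) * f S)"
proof -
  let ?R = "{S. S \<subseteq> U \<and> odd (card S) \<and> 2 * m < card S}"
  have "set ` odd_cycles U m \<subseteq> ?R"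
    using length_odd_cycle[of _ U m] by (auto simp: odd_cycles_def)
  then have "(\<Sum>c\<in>odd_cycles U m. f (set c)) =
      (\<Sum>S\<in>?R. of_nat (card {c \<in> odd_cycles U m. set c = S}) * f S)"
    by (intro sum_fun_comp finite_odd_cycles assms(1)) (use assms(1) in auto)
  also have "\<dots> =
      (\<Sum>S\<in>?R. of_nat (2 * card (descent_class (S - {Min S}) {D. card D = m - 1})) * f S)"
  proof (rule sum.cong[OF refl])
    fix S assume odd_S: "S \<in> ?R"
    then have "{c \<in> odd_cycles U m. set c = S} =
        {c. canonical_cycle c \<and> set c = S \<and> cycle_M c = m}"
      by (auto simp: odd_cycles_def canonical_cycle_def distinct_card)
    then show "of_nat (card {c \<in> odd_cycles U m. set c = S}) * f S =
        of_nat (2 * card (descent_class (S - {Min S}) {D. card D = m - 1})) * f S"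
      using odd_S card_canonical_cycles_cycle_M[OF assms(2), of S] by simp
  qed
  finally show ?thesis .
qed

lemma sum_odd_cycles_1:
  fixes f :: "nat \<Rightarrow> int"
  assumes "finite U"
  shows "(\<Sum>c\<in>odd_cycles U 1. f (length c)) =
    2 * odd_choose_sum (card U) f - 2 * int (card U) * f 1"
proof -
  have "(\<Sum>c\<in>odd_cycles U 1. f (length c)) = (\<Sum>c\<in>odd_cycles U 1. f (card (set c)))"
    using length_odd_cycle(1) by (intro sum.cong refl arg_cong[of _ _ f]) blast
  also have "\<dots> = (\<Sum>S | S \<subseteq> U \<and> odd (card S) \<and> 2 * 1 < card S. 2 * f (card S))"
    unfolding sum_odd_cycles[OF assms zero_less_one, of "\<lambda>S. f (card S)"]
    by (intro sum.cong refl) (auto simp: card_no_descents finite_subset[OF _ assms])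
  also have "\<dots> = 2 * odd_choose_sum (card U) f - 2 * int (card U) * f 1"
    using sum_large_odd_subsets[OF assms, where m = 1 and f = "\<lambda>k. 2 * f k"]
    by (simp add: odd_choose_sum_mult)
  finally show ?thesis .
qed

lemma card_odd_cycles_1:
  assumes "finite U"
  shows "int (card (odd_cycles U 1)) = 2 ^ card U - 0 ^ card U - 2 * int (card U)"
  using sum_odd_cycles_1[OF assms, of "\<lambda>k. 1"] odd_choose_sum_1[of "card U"] by simp

lemma card_odd_cycles_2:
  assumes "finite U" "2 \<le> card U"
  shows "2 * int (card (odd_cycles U 2)) =
    3 ^ card U - (-1) ^ card U - int (card U) * 2 ^ card U - 4 * int (card U choose 3)"
proof -
  let ?n = "card U" and ?count = "\<lambda>k. 2 ^ k - 2 * int k"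
  have "int (card (odd_cycles U 2)) = (\<Sum>S | S \<subseteq> U \<and> odd (card S) \<and> 2 * 2 < card S.
      2 * int (card (descent_class (S - {Min S}) {D. card D = 1})))"
    using sum_odd_cycles[OF assms(1), of 2 "\<lambda>S. 1 :: int"] by simp
  also have "\<dots> = (\<Sum>S | S \<subseteq> U \<and> odd (card S) \<and> 2 * 2 < card S. ?count (card S))"
  proof (rule sum.cong[OF refl])
    fix S assume "S \<in> {S. S \<subseteq> U \<and> odd (card S) \<and> 2 * 2 < card S}"
    then have "finite S" "S \<noteq> {}" and card_pos: "0 < card S"
      by (auto intro: finite_subset[OF _ assms(1)])
    then have "int (card (descent_class (S - {Min S}) {D. card D = 1})) =
        2 ^ (card S - 1) - int (card S)"
      using card_one_descent[of "S - {Min S}"] by simp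
    moreover have "2 ^ card S = 2 ^ (card S - 1) * (2 :: int)"
      using power_minus_mult[OF card_pos, of "2 :: int"] by simp
    ultimately show "2 * int (card (descent_class (S - {Min S}) {D. card D = 1})) = ?count (card S)"
      by simp
  qed
  also have "\<dots> = odd_choose_sum ?n ?count - 2 * int (?n choose 3)"
    unfolding sum_large_odd_subsets[OF assms(1), where m = 2 and f = ?count]
    by (simp add: lessThan_nat_numeral)
  finally show ?thesis
    using odd_choose_sum_power[of ?n "2 :: int" 1] odd_choose_sum_id[OF assms(2), where 'a = int]
    by (simp add: odd_choose_sum_diff odd_choose_sum_mult)
qed

definition disjoint_cycle_pairs :: "nat list set \<Rightarrow> (nat list \<times> nat list) set" where
  "disjoint_cycle_pairs K = {(c, d). c \<in> K \<and> d \<in> K \<and> disjnt (set c) (set d)}"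

lemma card_disjoint_odd_cycle_pairs_eq_sum:
  assumes "finite U"
  shows "int (card (disjoint_cycle_pairs (odd_cycles U 1))) = (\<Sum>c\<in>odd_cycles U 1.
    2 ^ (card U - length c) - 0 ^ (card U - length c) - 2 * int (card U - length c))"
proof -
  have "disjoint_cycle_pairs (odd_cycles U 1) = (SIGMA c:odd_cycles U 1. odd_cycles (U - set c) 1)"
    by (auto simp: disjoint_cycle_pairs_def odd_cycles_def disjnt_iff)
  then have "int (card (disjoint_cycle_pairs (odd_cycles U 1))) =
      (\<Sum>c\<in>odd_cycles U 1. int (card (odd_cycles (U - set c) 1)))"
    using assms by (simp add: finite_odd_cycles)
  also have "\<dots> = (\<Sum>c\<in>odd_cycles U 1.
      2 ^ (card U - length c) - 0 ^ (card U - length c) - 2 * int (card U - length c))"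
  proof (rule sum.cong[OF refl])
    fix c assume "c \<in> odd_cycles U 1"
    then have "card (U - set c) = card U - length c"
      using length_odd_cycle(1)[of c U 1] by (simp add: odd_cycles_def card_Diff_subset)
    then show "int (card (odd_cycles (U - set c) 1)) =
        2 ^ (card U - length c) - 0 ^ (card U - length c) - 2 * int (card U - length c)"
      using card_odd_cycles_1[of "U - set c"] assms by simp
  qed
  finally show ?thesis .
qed

lemma card_disjoint_odd_cycle_pairs:
  assumes "finite U" "2 \<le> card U"
  shows "int (card (disjoint_cycle_pairs (odd_cycles U 1))) =
    3 ^ card U - 2 + (-1) ^ card U - 2 * int (card U) * 2 ^ card U + 8 * int (card U choose 2)"
proof -
  let ?n = "card U"
  let ?count = "\<lambda>k. 2 ^ (?n - k) - 0 ^ (?n - k) - 2 * int (?n - k)"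
  have "int (card (disjoint_cycle_pairs (odd_cycles U 1))) =
      2 * odd_choose_sum ?n ?count - 2 * int ?n * ?count 1"
    unfolding card_disjoint_odd_cycle_pairs_eq_sum[OF assms(1)]
    by (rule sum_odd_cycles_1[OF assms(1)])
  also have "?count 1 = 2 ^ (?n - 1) - 2 * (int ?n - 1)"
    using assms(2) by (simp add: of_nat_diff)
  also have "odd_choose_sum ?n ?count = odd_choose_sum ?n (\<lambda>k. 2 ^ (?n - k)) -
      odd_choose_sum ?n (\<lambda>k. 0 ^ (?n - k)) - 2 * odd_choose_sum ?n (\<lambda>k. int (?n - k))"
    by (simp only: odd_choose_sum_diff odd_choose_sum_mult)
  finally have "int (card (disjoint_cycle_pairs (odd_cycles U 1))) =
      2 * (odd_choose_sum ?n (\<lambda>k. 2 ^ (?n - k)) - odd_choose_sum ?n (\<lambda>k. 0 ^ (?n - k)) -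
        2 * odd_choose_sum ?n (\<lambda>k. int (?n - k))) -
      2 * int ?n * (2 ^ (?n - 1) - 2 * (int ?n - 1))" .
  also have "\<dots> = 3 ^ ?n - 2 + (-1) ^ ?n - 2 * int ?n * 2 ^ ?n + 4 * (int ?n * (int ?n - 1))"
  proof -
    have "2 * odd_choose_sum ?n (\<lambda>k. 2 ^ (?n - k)) = (3 ^ ?n - 1 :: int)"
      "2 * odd_choose_sum ?n (\<lambda>k. 0 ^ (?n - k)) = (1 - (-1) ^ ?n :: int)"
      using odd_choose_sum_power[of ?n "1 :: int" 2] odd_choose_sum_power[of ?n "1 :: int" 0]
      by simp_all
    moreover have "2 ^ ?n = 2 ^ (?n - 1) * (2 :: int)"
      by (rule power_minus_mult[symmetric]) (use assms(2) in simp)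
    ultimately show ?thesis
      using odd_choose_sum_complement[OF assms(2), where 'a = int] by (simp add: algebra_simps)
  qed
  finally show ?thesis using double_int_choose_two[of ?n] by simp
qed

section \<open>Permutations with odd cycles\<close>

lemma odd_cycle_number_eq_card_cycle_sets:
  "odd_cycle_number n d =
    card {K \<in> disjoint_cycle_sets {1..n}. (\<forall>c\<in>K. odd (length c)) \<and> sum cycle_M K = d}"
proof -
  have trivial_cycle: "length c = 1 \<and> cycle_M c = 0"
    if "\<pi> permutes {1..n}" "c \<in> perm_cycles n \<pi>" "c \<notin> nontrivial_cycles n \<pi>" for \<pi> c
  proof -
    have "c \<noteq> []" "\<not> 2 \<le> length c"
      using that by (auto simp: nontrivial_cycles_def perm_cycles_iff canonical_cycle_def)
    then have "length c = 1" by (simp add: not_le less_2_cases_iff)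
    then show ?thesis using double_cycle_M_le[of c] by simp
  qed
  have "(\<forall>c\<in>perm_cycles n \<pi>. odd (length c)) \<longleftrightarrow> (\<forall>c\<in>nontrivial_cycles n \<pi>. odd (length c))"
    "perm_M n \<pi> = sum cycle_M (nontrivial_cycles n \<pi>)" if "\<pi> permutes {1..n}" for \<pi>
  proof -
    have subset: "nontrivial_cycles n \<pi> \<subseteq> perm_cycles n \<pi>" by (auto simp: nontrivial_cycles_def)
    show "(\<forall>c\<in>perm_cycles n \<pi>. odd (length c)) \<longleftrightarrow> (\<forall>c\<in>nontrivial_cycles n \<pi>. odd (length c))"
      using trivial_cycle[OF that] subset by (metis odd_one subsetD)
    show "perm_M n \<pi> = sum cycle_M (nontrivial_cycles n \<pi>)"
      unfolding perm_M_def
      by (rule sum.mono_neutral_right[OF finite_perm_cycles subset])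
         (use trivial_cycle[OF that] in blast)
  qed
  then have "odd_cycle_number n d = card {\<pi> \<in> {\<pi>. \<pi> permutes {1..n}}.
      (\<forall>c\<in>nontrivial_cycles n \<pi>. odd (length c)) \<and> sum cycle_M (nontrivial_cycles n \<pi>) = d}"
    unfolding odd_cycle_number_def by (intro arg_cong[of _ _ card]) auto
  also have "\<dots> =
      card {K \<in> disjoint_cycle_sets {1..n}. (\<forall>c\<in>K. odd (length c)) \<and> sum cycle_M K = d}"
    by (rule bij_betw_same_card[OF bij_betw_Collect[OF bij_betw_nontrivial_cycles]]) simp
  finally show ?thesis .
qed

lemma odd_cycles_iff_length_ge_2:
  assumes "0 < m"
  shows "c \<in> odd_cycles U m \<longleftrightarrow>
    canonical_cycle c \<and> set c \<subseteq> U \<and> 2 \<le> length c \<and> odd (length c) \<and> cycle_M c = m"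
  using assms length_odd_cycle(2)[of c U m] by (auto simp: odd_cycles_def)

lemma odd_disjoint_cycle_set_sum_2_cases:
  assumes "finite U" "K \<in> disjoint_cycle_sets U" "\<forall>c\<in>K. odd (length c)" "sum cycle_M K = 2"
  obtains (single) c where "K = {c}" "c \<in> odd_cycles U 2"
  | (pair) c d where "K = {c, d}" "(c, d) \<in> disjoint_cycle_pairs (odd_cycles U 1)"
proof -
  have odd_cycle: "c \<in> odd_cycles U (cycle_M c) \<and> 0 < cycle_M c" if "c \<in> K" for c
    using assms(2,3) that cycle_M_pos by (auto simp: disjoint_cycle_sets_def odd_cycles_def)
  consider (one) c where "K = {c}" "cycle_M c = 2"
    | (two) c d where "c \<noteq> d" "K = {c, d}" "cycle_M c = 1" "cycle_M d = 1"
    using sum_eq_2_iff[OF finite_disjoint_cycle_set[OF assms(2,1)], of cycle_M] odd_cycle assms(4)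
    by blast
  then show ?thesis
  proof cases
    case (one c)
    then show ?thesis using odd_cycle[of c] single by simp
  next
    case (two c d)
    then have "disjnt (set c) (set d)"
      using assms(2) by (auto simp: disjoint_cycle_sets_def pairwise_def)
    then have "(c, d) \<in> disjoint_cycle_pairs (odd_cycles U 1)"
      using two odd_cycle[of c] odd_cycle[of d] by (simp add: disjoint_cycle_pairs_def)
    then show ?thesis using two(2) pair by blast
  qed
qed

lemma disjoint_cycle_pair_neq:
  assumes "(c, d) \<in> disjoint_cycle_pairs (odd_cycles U m)"
  shows "c \<noteq> d"
  using assms by (auto simp: disjoint_cycle_pairs_def odd_cycles_def canonical_cycle_def)

lemma odd_disjoint_cycle_sets_sum_2:
  assumes "finite U"
  shows "{K \<in> disjoint_cycle_sets U. (\<forall>c\<in>K. odd (length c)) \<and> sum cycle_M K = 2} =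
    (\<lambda>c. {c}) ` odd_cycles U 2 \<union> (\<lambda>(c, d). {c, d}) ` disjoint_cycle_pairs (odd_cycles U 1)"
    (is "?L = ?singles \<union> ?pairs")
proof
  show "?L \<subseteq> ?singles \<union> ?pairs"
  proof
    fix K assume "K \<in> ?L"
    then have "K \<in> disjoint_cycle_sets U" "\<forall>c\<in>K. odd (length c)" "sum cycle_M K = 2" by auto
    then show "K \<in> ?singles \<union> ?pairs"
      by (cases rule: odd_disjoint_cycle_set_sum_2_cases[OF assms]) auto
  qed
  have "?singles \<subseteq> ?L"
    by (auto simp: disjoint_cycle_sets_def odd_cycles_iff_length_ge_2)
  moreover have "{c, d} \<in> ?L" if "(c, d) \<in> disjoint_cycle_pairs (odd_cycles U 1)" for c d
    using that disjoint_cycle_pair_neq[OF that]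
    by (auto simp: disjoint_cycle_pairs_def disjoint_cycle_sets_def odd_cycles_iff_length_ge_2
        pairwise_insert disjnt_sym)
  ultimately show "?singles \<union> ?pairs \<subseteq> ?L" by auto
qed

lemma double_odd_cycle_number_2:
  "2 * odd_cycle_number n 2 =
    2 * card (odd_cycles {1..n} 2) + card (disjoint_cycle_pairs (odd_cycles {1..n} 1))"
proof -
  let ?single = "\<lambda>c. {c}" and ?pair = "\<lambda>(c, d). {c, d}"
  let ?P = "disjoint_cycle_pairs (odd_cycles {1..n} 1)"
  have "?P \<subseteq> odd_cycles {1..n} 1 \<times> odd_cycles {1..n} 1"
    by (auto simp: disjoint_cycle_pairs_def)
  then have finite: "finite ?P"
    by (rule finite_subset) (simp add: finite_odd_cycles)
  have sym: "(d, c) \<in> ?P \<and> c \<noteq> d" if "(c, d) \<in> ?P" for c d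
    using that disjoint_cycle_pair_neq[OF that] by (auto simp: disjoint_cycle_pairs_def disjnt_sym)
  have "odd_cycle_number n 2 = card (?single ` odd_cycles {1..n} 2 \<union> ?pair ` ?P)"
    by (simp add: odd_cycle_number_eq_card_cycle_sets odd_disjoint_cycle_sets_sum_2)
  also have "\<dots> = card (?single ` odd_cycles {1..n} 2) + card (?pair ` ?P)"
    by (rule card_Un_disjoint) (use finite sym in \<open>auto simp: finite_odd_cycles\<close>)
  also have "card (?single ` odd_cycles {1..n} 2) = card (odd_cycles {1..n} 2)"
    by (simp add: card_image)
  finally show ?thesis
    using card_unordered_pairs[OF finite sym] by simp
qed

lemma odd_cycle_number_2:
  assumes "2 \<le> n"
  shows "int (odd_cycle_number n 2) = 3 ^ n - 3 * int n * 2 ^ (n - 1) + 4 * int (n choose 2)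
    - 2 * int (n choose 3) - 1"
proof -
  have "2 ^ n = 2 ^ (n - 1) * (2 :: int)"
    by (rule power_minus_mult[symmetric]) (use assms in simp)
  moreover have "2 * int (odd_cycle_number n 2) =
      2 * int (card (odd_cycles {1..n} 2)) +
      int (card (disjoint_cycle_pairs (odd_cycles {1..n} 1)))"
    using arg_cong[OF double_odd_cycle_number_2[of n], of int] by simp
  ultimately show ?thesis
    using card_odd_cycles_2[of "{1..n}"] card_disjoint_odd_cycle_pairs[of "{1..n}"] assms
    by simp
qed

theorem theorem1p4:
  fixes n :: nat
  assumes "n \<ge> 2"
  shows "ballot_number n 2 = odd_cycle_number n 2 \<and>
         int (odd_cycle_number n 2) =
           3 * int (eulerian (n - 1) 2) - 2 * int (n choose 3) + int (n choose 2) - 1"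
proof -
  have "int (ballot_number n 2) = int (odd_cycle_number n 2)"
    by (simp only: ballot_number_2[OF assms] odd_cycle_number_2[OF assms])
  moreover have "3 * int (eulerian (n - 1) 2) =
      3 ^ n - 3 * int n * 2 ^ (n - 1) + 3 * int (n choose 2)"
    using assms by (cases n) (simp_all add: eulerian_2 algebra_simps)
  ultimately show ?thesis
    using odd_cycle_number_2[OF assms] by simp
qed

end
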